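(* Fix $k\ge1$ and $\pi\in\mathcal S_k$. For each $n$ let $\theta_1=\theta_1^{(n)},\dots,\theta_n=\theta_n^{(n)}$ be positive real weights (allowed to depend on $n$), let $\sigma_n\sim\mathrm{Luce}(\theta_1,\dots,\theta_n)$, and assume that the limit $$\Lambda(\pi):=\lim_{n\to+\infty}\frac1n\sum_{i=0}^{n-k}p\left(\theta_{i+\pi^{-1}(1)},\dots,\theta_{i+\pi^{-1}(k)}\right)$$ exists. Then $$\widetilde{\mathrm{c\text{-}occ}}(\pi,\sigma_n)\to\Lambda(\pi)$$ in probability as $n\to\infty$.
   Context: For positive reals $x_1,\dots,x_k$ with $w=x_1+\dots+x_k$, $$p(x_1,\dots,x_k):=\frac{x_1}{w}\cdot\frac{x_2}{w-x_1}\cdot\frac{x_3}{w-x_1-x_2}\cdots\frac{x_k}{x_k}.$$ $\mathcal S_n$ is the set of permutations of $[n]=\{1,\dots,n\}$. A random permutation $\sigma_n\in\mathcal S_n$ is $\mathrm{Luce}(\theta_1,\dots,\theta_n)$-distributed if $\mathbb P(\sigma_n=\sigma)=p(\theta_{\sigma^{-1}(1)},\dots,\theta_{\sigma^{-1}(n)})$ for all $\sigma\in\mathcal S_n$. For $\sigma\in\mathcal S_n$ and $I=\{i_1<\dots<i_k\}\subset[n]$, $\mathrm{pat}_I(\sigma)\in\mathcal S_k$ is the permutation with the same relative order as $\sigma(i_1),\dots,\sigma(i_k)$. For $\pi\in\mathcal S_k$, $\mathrm{c\text{-}occ}(\pi,\sigma):=\#\{I\subseteq[n]:\#I=k,\ I\text{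 an interval of integers},\ \mathrm{pat}_I(\sigma)=\pi\}$ and $\widetilde{\mathrm{c\text{-}occ}}(\pi,\sigma):=\mathrm{c\text{-}occ}(\pi,\sigma)/n$. *)

theory Defs
  imports "HOL-Probability.Probability" "HOL-Combinatorics.Permutations"
begin

text \<open>Permutations of \<open>[n]\<close> are functions on \<^typ>\<open>nat\<close> with \<open>\<sigma> permutes {1..n}\<close>,
  so the identity outside \<open>{1..n}\<close>.\<close>

text \<open>The denominator for the list position \<open>j\<close> (counted from 0) is \<open>w\<close> minus the entries
  before it.\<close>

definition luce_p :: "real list \<Rightarrow> real" where
  "luce_p xs = (\<Prod>j<length xs. xs ! j / (sum_list xs - sum_list (take j xs)))"

definition luce_distributed ::
    "'a measure \<Rightarrow> ('a \<Rightarrow> nat \<Rightarrow> nat) \<Rightarrow> nat \<Rightarrow> (nat \<Rightarrow> real) \<Rightarrow> bool" where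
  "luce_distributed M X n \<theta> \<longleftrightarrow>
     X \<in> M \<rightarrow>\<^sub>M count_space {\<sigma>. \<sigma> permutes {1..n}} \<and>
     (\<forall>\<sigma>. \<sigma> permutes {1..n} \<longrightarrow>
        measure M {\<omega> \<in> space M. X \<omega> = \<sigma>} = luce_p (map (\<lambda>j. \<theta> (inv \<sigma> j)) [1..<n + 1]))"

text \<open>The \<open>j\<close>-th smallest element of \<open>I\<close>, with \<open>j\<close> counted from 1.\<close>

definition nth_elem :: "nat set \<Rightarrow> nat \<Rightarrow> nat" where
  "nth_elem I j = sorted_list_of_set I ! (j - 1)"

definition same_order :: "nat set \<Rightarrow> (nat \<Rightarrow> nat) \<Rightarrow> (nat \<Rightarrow> nat) \<Rightarrow> bool" where
  "same_order I \<sigma> \<tau> \<longleftrightarrow>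
     (\<forall>a\<in>{1..card I}. \<forall>b\<in>{1..card I}.
        \<tau> a < \<tau> b \<longleftrightarrow> \<sigma> (nth_elem I a) < \<sigma> (nth_elem I b))"

definition pat :: "nat set \<Rightarrow> (nat \<Rightarrow> nat) \<Rightarrow> nat \<Rightarrow> nat" where
  "pat I \<sigma> = (THE \<tau>. \<tau> permutes {1..card I} \<and> same_order I \<sigma> \<tau>)"

lemma perm_eq_rank:
  fixes \<tau> :: "nat \<Rightarrow> nat"
  assumes "\<tau> permutes {1..k}" "a \<in> {1..k}"
  shows "\<tau> a = card {b \<in> {1..k}. \<tau> b < \<tau> a} + 1"
proof -
  have im: "\<tau> ` {1..k} = {1..k}"
    using assms(1) by (rule permutes_image)
  have ta: "\<tau> a \<in> {1..k}"
    using assms im by blast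
  have "\<tau> ` {b \<in> {1..k}. \<tau> b < \<tau> a} = {c \<in> \<tau> ` {1..k}. c < \<tau> a}"
    by blast
  also have "\<dots> = {1..<\<tau> a}"
    using ta unfolding im by auto
  finally have img: "\<tau> ` {b \<in> {1..k}. \<tau> b < \<tau> a} = {1..<\<tau> a}" .
  have "card {b \<in> {1..k}. \<tau> b < \<tau> a} = card (\<tau> ` {b \<in> {1..k}. \<tau> b < \<tau> a})"
    by (rule card_image[symmetric]) (rule permutes_inj_on[OF assms(1)])
  then show ?thesis
    using img ta by simp
qed

lemma inj_on_nth_elem:
  assumes "finite I"
  shows "inj_on (nth_elem I) {1..card I}" "nth_elem I ` {1..card I} \<subseteq> I"
proof -
  have len: "length (sorted_list_of_set I) = card I"
    by simp
  show "inj_on (nth_elem I) {1..card I}"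
  proof (rule inj_onI)
    fix a b assume ab: "a \<in> {1..card I}" "b \<in> {1..card I}" "nth_elem I a = nth_elem I b"
    then have "a - 1 = b - 1"
      unfolding nth_elem_def
      using nth_eq_iff_index_eq[of "sorted_list_of_set I" "a - 1" "b - 1"] len by auto
    then show "a = b"
      using ab by auto
  qed
  show "nth_elem I ` {1..card I} \<subseteq> I"
  proof
    fix x assume "x \<in> nth_elem I ` {1..card I}"
    then obtain j where j: "j \<in> {1..card I}" "x = nth_elem I j" by blast
    then have "x \<in> set (sorted_list_of_set I)"
      unfolding nth_elem_def by (auto intro!: nth_mem)
    then show "x \<in> I"
      using assms by simp
  qed
qed

lemma pat_ex1:
  assumes fin: "finite I" and inj: "inj_on \<sigma> I"
  shows "\<exists>!\<tau>. \<tau> permutes {1..card I} \<and> same_order I \<sigma> \<tau>"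
proof -
  define k where "k = card I"
  define f where "f j = \<sigma> (nth_elem I j)" for j
  define \<tau> where "\<tau> j = (if j \<in> {1..k} then card {b \<in> {1..k}. f b < f j} + 1 else j)" for j
  have injf: "inj_on f {1..k}"
    unfolding f_def k_def
    using comp_inj_on[OF inj_on_nth_elem(1)[OF fin] inj_on_subset[OF inj inj_on_nth_elem(2)[OF fin]]]
    by (simp add: comp_def)
  have less_tau: "\<tau> a < \<tau> b" if "a \<in> {1..k}" "b \<in> {1..k}" "f a < f b" for a b
  proof -
    have "{c \<in> {1..k}. f c < f a} \<subset> {c \<in> {1..k}. f c < f b}"
      using that by auto
    then have "card {c \<in> {1..k}. f c < f a} < card {c \<in> {1..k}. f c < f b}"
      by (intro psubset_card_mono) auto
    then show ?thesis
      using that by (simp add: \<tau>_def)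
  qed
  have iff: "\<tau> a < \<tau> b \<longleftrightarrow> f a < f b" if "a \<in> {1..k}" "b \<in> {1..k}" for a b
  proof (cases "f a" "f b" rule: linorder_cases)
    case less
    then show ?thesis using less_tau that by blast
  next
    case equal
    then have "a = b" using injf that by (simp add: inj_on_eq_iff)
    then show ?thesis by simp
  next
    case greater
    then have "\<tau> b < \<tau> a" using less_tau that by blast
    then show ?thesis using greater by simp
  qed
  have injt: "inj_on \<tau> {1..k}"
  proof (rule inj_onI)
    fix a b assume ab: "a \<in> {1..k}" "b \<in> {1..k}" "\<tau> a = \<tau> b"
    then have "\<not> f a < f b" "\<not> f b < f a"
      using less_tau[of a b] less_tau[of b a] by auto
    then have "f a = f b" by simp
    then show "a = b" using injf ab(1,2) by (simp add: inj_on_eq_iff)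
  qed
  have sub: "\<tau> ` {1..k} \<subseteq> {1..k}"
  proof
    fix y assume "y \<in> \<tau> ` {1..k}"
    then obtain j where j: "j \<in> {1..k}" "y = \<tau> j" by blast
    have "{b \<in> {1..k}. f b < f j} \<subset> {1..k}"
      using j by blast
    then have "card {b \<in> {1..k}. f b < f j} < card {1..k}"
      by (intro psubset_card_mono) auto
    then show "y \<in> {1..k}"
      using j by (simp add: \<tau>_def)
  qed
  have "bij_betw \<tau> {1..k} {1..k}"
    using injt sub by (simp add: bij_betw_def endo_inj_surj)
  then have "\<tau> permutes {1..k}"
    by (rule bij_imp_permutes) (auto simp: \<tau>_def)
  moreover have "same_order I \<sigma> \<tau>"
    using iff by (simp add: same_order_def f_def k_def)
  moreover have "\<rho> = \<tau>" if "\<rho> permutes {1..k}" "same_order I \<sigma> \<rho>" for \<rho>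
  proof
    fix a
    show "\<rho> a = \<tau> a"
    proof (cases "a \<in> {1..k}")
      case True
      have "{b \<in> {1..k}. \<rho> b < \<rho> a} = {b \<in> {1..k}. f b < f a}"
        using that(2) True by (auto simp: same_order_def f_def k_def)
      then show ?thesis
        using perm_eq_rank[OF that(1) True] True by (simp add: \<tau>_def)
    next
      case False
      then show ?thesis
        using that(1) by (auto simp: \<tau>_def permutes_def)
    qed
  qed
  ultimately show ?thesis
    unfolding k_def by blast
qed

definition c_occ :: "nat \<Rightarrow> nat \<Rightarrow> (nat \<Rightarrow> nat) \<Rightarrow> (nat \<Rightarrow> nat) \<Rightarrow> nat" where
  "c_occ k n \<pi> \<sigma> =
     card {I. I \<subseteq> {1..n} \<and> card I = k \<and> (\<exists>a b. I = {a..b}) \<and> pat I \<sigma> = \<pi>}"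

definition c_occ_density :: "nat \<Rightarrow> nat \<Rightarrow> (nat \<Rightarrow> nat) \<Rightarrow> (nat \<Rightarrow> nat) \<Rightarrow> real" where
  "c_occ_density k n \<pi> \<sigma> = real (c_occ k n \<pi> \<sigma>) / real n"

text \<open>Convergence in probability to a constant; the variables may live on different spaces.\<close>

definition tendsto_in_prob ::
    "(nat \<Rightarrow> 'a measure) \<Rightarrow> (nat \<Rightarrow> 'a \<Rightarrow> real) \<Rightarrow> real \<Rightarrow> bool" where
  "tendsto_in_prob M X c \<longleftrightarrow>
     (\<forall>\<epsilon>>0. (\<lambda>n. measure (M n) {\<omega> \<in> space (M n). \<bar>X n \<omega> - c\<bar> > \<epsilon>}) \<longlonglongrightarrow> 0)"

end

theory Submission
  imports Defs "HOL-Combinatorics.Multiset_Permutations"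
begin

text \<open>
  Read a permutation \<open>\<sigma>\<close> of \<open>[n]\<close> as the ordering \<open>\<sigma>\<inverse>(1), \<dots>, \<sigma>\<inverse>(n)\<close> of the items
  \<open>1, \<dots>, n\<close>. Under the Luce law this ordering arises by repeatedly drawing one of the remaining
  items with probability proportional to its weight. Equivalently, the items ring independent
  exponential clocks and are listed in order of ringing. The clock picture explains two facts:
  the items of a set \<open>A\<close> are ordered by the Luce law of their own weights, and the orders inside
  disjoint sets are independent.

  Here both facts come from one algebraic identity, which needs no clocks: the Luce probabilities
  of all the shuffles of two lists add up to the product of the Luce probabilities of the lists
  (\<open>sum_luce_p_shuffles\<close>). Since an ordering of \<open>S\<close> is a shuffle of its restrictions to \<open>A\<close> and
  to \<open>S - A\<close>, the identity makes these restrictions independent (\<open>sum_luce_p_split\<close>).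

  The pattern of \<open>\<sigma>\<close> on the window \<open>{i+1..i+k}\<close> is \<open>\<pi>\<close> exactly if the ordering restricted to the
  window is \<open>i + \<pi>\<inverse>(1), \<dots>, i + \<pi>\<inverse>(k)\<close> (\<open>pat_window_eq_iff\<close>). So the \<open>i\<close>-th summand in the
  definition of \<open>\<Lambda>\<close> is the probability of this event, and the events for disjoint windows are
  independent. The number of occurrences is thus a sum of at most \<open>n\<close> indicators with at most
  \<open>2kn\<close> correlated pairs, its variance is \<open>O(n)\<close>, and Chebyshev's inequality concludes.
\<close>

section \<open>Luce weights of shuffles\<close>

lemma luce_p_Nil [simp]: "luce_p [] = 1"
  by (simp add: luce_p_def)

lemma luce_p_Cons: "luce_p (x # xs) = x / sum_list (x # xs) * luce_p xs"
  unfolding luce_p_def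
  by (simp only: list.size add_0_right add_Suc_right prod.lessThan_Suc_shift) simp

text \<open>The first letter of a shuffle comes from the left list with probability proportional to its
  total weight \<open>u\<close>, otherwise from the right one with total weight \<open>v\<close>. Either way the induction
  hypothesis turns what follows into the same product, and \<open>u / (u + v) + v / (u + v) = 1\<close>.\<close>

lemma sum_luce_p_shuffles:
  fixes f :: "'b \<Rightarrow> real"
  assumes "set xs \<inter> set ys = {}" "\<And>x. x \<in> set xs \<union> set ys \<Longrightarrow> f x > 0"
  shows "(\<Sum>zs\<in>shuffles xs ys. luce_p (map f zs)) = luce_p (map f xs) * luce_p (map f ys)"
  using assms
proof (induction xs ys rule: shuffles.induct)
  case (3 x xs y ys)
  define u where "u = sum_list (map f (x # xs))"
  define v where "v = sum_list (map f (y # ys))"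
  have pos: "u > 0" "v > 0"
    unfolding u_def v_def list.map sum_list.Cons using "3.prems"(2)
    by (auto intro!: add_pos_nonneg[OF _ sum_list_nonneg] less_imp_le)
  have total: "sum_list (map f zs) = sum_list (map f as) + sum_list (map f bs)"
    if "zs \<in> shuffles as bs" for zs as bs
    using that
    by (induction as bs arbitrary: zs rule: shuffles.induct) (fastforce simp: algebra_simps)+
  have left: "(\<Sum>zs\<in>(#) x ` shuffles xs (y # ys). luce_p (map f zs))
      = f x / (u + v) * (luce_p (map f xs) * luce_p (map f (y # ys)))"
  proof -
    have "(\<Sum>zs\<in>(#) x ` shuffles xs (y # ys). luce_p (map f zs))
        = (\<Sum>zs\<in>shuffles xs (y # ys). f x / (u + v) * luce_p (map f zs))"
      by (subst sum.reindex)
        (auto simp: luce_p_Cons u_def v_def total algebra_simps intro!: sum.cong)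
    also have "\<dots> = f x / (u + v) * (\<Sum>zs\<in>shuffles xs (y # ys). luce_p (map f zs))"
      by (simp only: sum_distrib_left)
    also have "(\<Sum>zs\<in>shuffles xs (y # ys). luce_p (map f zs))
        = luce_p (map f xs) * luce_p (map f (y # ys))"
      using "3.prems" by (intro "3.IH"(1)) auto
    finally show ?thesis .
  qed
  have right: "(\<Sum>zs\<in>(#) y ` shuffles (x # xs) ys. luce_p (map f zs))
      = f y / (u + v) * (luce_p (map f (x # xs)) * luce_p (map f ys))"
  proof -
    have "(\<Sum>zs\<in>(#) y ` shuffles (x # xs) ys. luce_p (map f zs))
        = (\<Sum>zs\<in>shuffles (x # xs) ys. f y / (u + v) * luce_p (map f zs))"
      by (subst sum.reindex)
        (auto simp: luce_p_Cons u_def v_def total algebra_simps intro!: sum.cong)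
    also have "\<dots> = f y / (u + v) * (\<Sum>zs\<in>shuffles (x # xs) ys. luce_p (map f zs))"
      by (simp only: sum_distrib_left)
    also have "(\<Sum>zs\<in>shuffles (x # xs) ys. luce_p (map f zs))
        = luce_p (map f (x # xs)) * luce_p (map f ys)"
      using "3.prems" by (intro "3.IH"(2)) auto
    finally show ?thesis .
  qed
  have lx: "luce_p (map f (x # xs)) = f x / u * luce_p (map f xs)"
    by (simp add: luce_p_Cons u_def)
  have ly: "luce_p (map f (y # ys)) = f y / v * luce_p (map f ys)"
    by (simp add: luce_p_Cons v_def)
  have "x \<noteq> y"
    using "3.prems"(1) by auto
  then have "(\<Sum>zs\<in>shuffles (x # xs) (y # ys). luce_p (map f zs))
      = (\<Sum>zs\<in>(#) x ` shuffles xs (y # ys). luce_p (map f zs))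
        + (\<Sum>zs\<in>(#) y ` shuffles (x # xs) ys. luce_p (map f zs))"
    unfolding shuffles.simps by (intro sum.union_disjoint) auto
  also have "\<dots> = f x / (u + v) * (luce_p (map f xs) * (f y / v * luce_p (map f ys)))
      + f y / (u + v) * (f x / u * luce_p (map f xs) * luce_p (map f ys))"
    unfolding left right lx ly ..
  also have "\<dots> = f x / u * luce_p (map f xs) * (f y / v * luce_p (map f ys))"
    using pos by (simp add: divide_simps add_pos_pos) (simp add: algebra_simps)
  finally show ?case
    unfolding lx ly .
qed simp_all

section \<open>Orders inside disjoint sets of items\<close>

text \<open>Independence of the orders inside \<open>A\<close> and inside \<open>S - A\<close>, with both marginal laws
  identified as Luce laws: the orderings of \<open>S\<close> are grouped by their two restrictions, and each
  group is the set of shuffles of these restrictions.\<close>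

lemma sum_luce_p_split:
  fixes f :: "'b \<Rightarrow> real"
  assumes fin: "finite S" and AS: "A \<subseteq> S" and pos: "\<And>x. x \<in> S \<Longrightarrow> f x > 0"
  shows "(\<Sum>zs | zs \<in> permutations_of_set S \<and> P (filter (\<lambda>x. x \<in> A) zs)
              \<and> Q (filter (\<lambda>x. x \<notin> A) zs). luce_p (map f zs))
    = (\<Sum>xs | xs \<in> permutations_of_set A \<and> P xs. luce_p (map f xs))
      * (\<Sum>ys | ys \<in> permutations_of_set (S - A) \<and> Q ys. luce_p (map f ys))"
proof -
  define Z where "Z = {zs \<in> permutations_of_set S. P (filter (\<lambda>x. x \<in> A) zs)
    \<and> Q (filter (\<lambda>x. x \<notin> A) zs)}"
  define X where "X = {xs \<in> permutations_of_set A. P xs}"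
  define Y where "Y = {ys \<in> permutations_of_set (S - A). Q ys}"
  define g where "g zs = (filter (\<lambda>x. x \<in> A) zs, filter (\<lambda>x. x \<notin> A) zs)" for zs :: "'b list"
  have fins: "finite Z" "finite X" "finite Y"
    by (simp_all add: Z_def X_def Y_def)
  have sub: "g ` Z \<subseteq> X \<times> Y"
    using AS by (auto simp: g_def Z_def X_def Y_def permutations_of_set_def)
  have fiber: "{zs \<in> Z. g zs = (xs, ys)} = shuffles xs ys" if "xs \<in> X" "ys \<in> Y" for xs ys
  proof (intro set_eqI iffI)
    fix zs assume "zs \<in> {zs \<in> Z. g zs = (xs, ys)}"
    then show "zs \<in> shuffles xs ys"
      using partition_in_shuffles[of zs "\<lambda>x. x \<in> A"] by (simp add: g_def)
  next
    fix zs assume zs: "zs \<in> shuffles xs ys"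
    have dis: "distinct xs" "distinct ys" "set xs = A" "set ys = S - A" "P xs" "Q ys"
      using that by (auto simp: X_def Y_def permutations_of_set_def)
    have "distinct zs"
      using distinct_disjoint_shuffles[of xs ys zs] dis zs by auto
    moreover have "set zs = S"
      using set_shuffles[OF zs] dis AS by auto
    moreover have "filter (\<lambda>x. x \<in> A) zs = xs" "filter (\<lambda>x. x \<notin> A) zs = ys"
      using filter_shuffles_disjoint1[of xs ys zs] dis zs by auto
    ultimately show "zs \<in> {zs \<in> Z. g zs = (xs, ys)}"
      using dis by (simp add: Z_def g_def permutations_of_set_def)
  qed
  have "(\<Sum>zs\<in>Z. luce_p (map f zs))
      = (\<Sum>p\<in>X \<times> Y. \<Sum>zs | zs \<in> Z \<and> g zs = p. luce_p (map f zs))"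
    by (rule sum.group[symmetric]) (use fins sub in auto)
  also have "\<dots> = (\<Sum>(xs, ys)\<in>X \<times> Y. luce_p (map f xs) * luce_p (map f ys))"
  proof (rule sum.cong[OF refl], clarify)
    fix xs ys assume xy: "xs \<in> X" "ys \<in> Y"
    have "(\<Sum>zs\<in>shuffles xs ys. luce_p (map f zs)) = luce_p (map f xs) * luce_p (map f ys)"
      using xy AS by (intro sum_luce_p_shuffles)
        (auto simp: X_def Y_def permutations_of_set_def intro!: pos)
    then show "(\<Sum>zs | zs \<in> Z \<and> g zs = (xs, ys). luce_p (map f zs))
        = luce_p (map f xs) * luce_p (map f ys)"
      by (simp add: fiber[OF xy])
  qed
  also have "\<dots> = (\<Sum>xs\<in>X. luce_p (map f xs)) * (\<Sum>ys\<in>Y. luce_p (map f ys))"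
    by (simp add: sum_product sum.cartesian_product)
  finally show ?thesis
    by (simp add: Z_def X_def Y_def)
qed

lemma sum_luce_p_permutations_of_set:
  fixes f :: "'b \<Rightarrow> real"
  assumes "finite S" "\<And>x. x \<in> S \<Longrightarrow> f x > 0"
  shows "(\<Sum>zs\<in>permutations_of_set S. luce_p (map f zs)) = 1"
  using assms
proof (induction S)
  case (insert x F)
  have "insert x F - {x} = F"
    using insert.hyps by auto
  moreover have "luce_p [f x] = 1"
    using insert.prems[of x] by (simp add: luce_p_Cons)
  ultimately show ?case
    using sum_luce_p_split[of "insert x F" "{x}" f "\<lambda>_. True" "\<lambda>_. True"] insert
    by simp
qed simp

lemma sum_luce_p_restriction:
  fixes f :: "'b \<Rightarrow> real"
  assumes "finite S" "A \<subseteq> S" "\<And>x. x \<in> S \<Longrightarrow> f x > 0" "xs \<in> permutations_of_set A"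
  shows "(\<Sum>zs | zs \<in> permutations_of_set S \<and> filter (\<lambda>x. x \<in> A) zs = xs. luce_p (map f zs))
    = luce_p (map f xs)"
proof -
  have "{as \<in> permutations_of_set A. as = xs} = {xs}"
    using assms(4) by auto
  then show ?thesis
    using sum_luce_p_split[of S A f "\<lambda>as. as = xs" "\<lambda>_. True"] assms
      sum_luce_p_permutations_of_set[of "S - A" f]
    by simp
qed

text \<open>Splitting off \<open>A\<close> leaves the Luce law on the orderings of \<open>S - A\<close>, where the order inside
  \<open>B\<close> is a single restriction again.\<close>

lemma sum_luce_p_disjoint_restrictions:
  fixes f :: "'b \<Rightarrow> real"
  assumes "finite S" "A \<subseteq> S" "B \<subseteq> S" "A \<inter> B = {}" "\<And>x. x \<in> S \<Longrightarrow> f x > 0"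
    and "xs \<in> permutations_of_set A" "ys \<in> permutations_of_set B"
  shows "(\<Sum>zs | zs \<in> permutations_of_set S \<and> filter (\<lambda>x. x \<in> A) zs = xs
             \<and> filter (\<lambda>x. x \<in> B) zs = ys. luce_p (map f zs))
    = luce_p (map f xs) * luce_p (map f ys)"
proof -
  have "{as \<in> permutations_of_set A. as = xs} = {xs}"
    using assms(6) by auto
  moreover have "filter (\<lambda>x. x \<in> B) (filter (\<lambda>x. x \<notin> A) zs) = filter (\<lambda>x. x \<in> B) zs" for zs
    using assms(4) by (auto intro!: filter_cong)
  moreover have "(\<Sum>zs | zs \<in> permutations_of_set (S - A) \<and> filter (\<lambda>x. x \<in> B) zs = ys.
      luce_p (map f zs)) = luce_p (map f ys)"
    using assms by (intro sum_luce_p_restriction) auto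
  ultimately show ?thesis
    using sum_luce_p_split[of S A f "\<lambda>as. as = xs" "\<lambda>bs. filter (\<lambda>x. x \<in> B) bs = ys"] assms
    by simp
qed

section \<open>Luce-distributed permutations as random orderings\<close>

definition ordering_of :: "nat \<Rightarrow> (nat \<Rightarrow> nat) \<Rightarrow> nat list" where
  "ordering_of n \<tau> = map (inv \<tau>) [1..<n + 1]"

lemma bij_betw_ordering_of:
  "bij_betw (ordering_of n) {\<tau>. \<tau> permutes {1..n}} (permutations_of_set {1..n})"
proof -
  have inj: "inj_on (ordering_of n) {\<tau>. \<tau> permutes {1..n}}"
  proof (rule inj_onI, clarify)
    fix \<tau> \<rho> assume tr: "\<tau> permutes {1..n}" "\<rho> permutes {1..n}"
      and eq: "ordering_of n \<tau> = ordering_of n \<rho>"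
    have "inv \<tau> j = inv \<rho> j" for j
    proof (cases "j \<in> {1..n}")
      case True
      then show ?thesis using eq by (auto simp: ordering_of_def)
    next
      case False
      then show ?thesis
        using permutes_inv[OF tr(1)] permutes_inv[OF tr(2)] by (auto simp: permutes_def)
    qed
    then have "inv \<tau> = inv \<rho>" by blast
    then show "\<tau> = \<rho>"
      using permutes_inv_inv tr by metis
  qed
  have sub: "ordering_of n ` {\<tau>. \<tau> permutes {1..n}} \<subseteq> permutations_of_set {1..n}"
  proof clarify
    fix \<tau> assume t: "\<tau> permutes {1..n}"
    have "set (ordering_of n \<tau>) = inv \<tau> ` {1..n}"
      by (auto simp: ordering_of_def)
    also have "\<dots> = {1..n}"
      using permutes_image[OF permutes_inv[OF t]] .
    finally show "ordering_of n \<tau> \<in> permutations_of_set {1..n}"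
      using permutes_inj_on[OF permutes_inv[OF t]]
      by (auto simp: permutations_of_set_def ordering_of_def distinct_map)
  qed
  have "card (ordering_of n ` {\<tau>. \<tau> permutes {1..n}}) = card (permutations_of_set {1..n})"
    unfolding card_image[OF inj] by (simp add: card_permutations[OF refl])
  then have "ordering_of n ` {\<tau>. \<tau> permutes {1..n}} = permutations_of_set {1..n}"
    using card_subset_eq[OF _ sub] by simp
  then show ?thesis
    using inj by (simp add: bij_betw_def)
qed

lemma luce_distributed_events:
  assumes "luce_distributed M X n \<theta>"
  shows "{\<omega> \<in> space M. P (X \<omega>)} \<in> sets M"
proof -
  have X: "X \<in> M \<rightarrow>\<^sub>M count_space {\<tau>. \<tau> permutes {1..n}}"
    using assms by (simp add: luce_distributed_def)
  then have "{\<omega> \<in> space M. P (X \<omega>)} = X -` {\<tau>. \<tau> permutes {1..n} \<and> P \<tau>} \<inter> space M"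
    by (auto dest: measurable_space)
  then show ?thesis
    using measurable_sets[OF X, of "{\<tau>. \<tau> permutes {1..n} \<and> P \<tau>}"] by auto
qed

lemma measure_ordering_of_luce:
  assumes M: "prob_space M" and luce: "luce_distributed M X n \<theta>"
  shows "measure M {\<omega> \<in> space M. Q (ordering_of n (X \<omega>))}
    = (\<Sum>zs | zs \<in> permutations_of_set {1..n} \<and> Q zs. luce_p (map \<theta> zs))"
proof -
  interpret prob_space M by fact
  define T where "T = {\<tau>. \<tau> permutes {1..n} \<and> Q (ordering_of n \<tau>)}"
  have finT: "finite T"
    using finite_permutations[of "{1..n}"] by (simp add: T_def)
  have X: "X \<in> M \<rightarrow>\<^sub>M count_space {\<tau>. \<tau> permutes {1..n}}"
    using luce by (simp add: luce_distributed_def)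
  have "{\<omega> \<in> space M. Q (ordering_of n (X \<omega>))} = (\<Union>\<tau>\<in>T. {\<omega> \<in> space M. X \<omega> = \<tau>})"
    using measurable_space[OF X] by (auto simp: T_def)
  then have "measure M {\<omega> \<in> space M. Q (ordering_of n (X \<omega>))}
      = (\<Sum>\<tau>\<in>T. measure M {\<omega> \<in> space M. X \<omega> = \<tau>})"
    using finT luce_distributed_events[OF luce]
    by (simp, intro finite_measure_finite_Union) (auto simp: disjoint_family_on_def)
  also have "\<dots> = (\<Sum>\<tau>\<in>T. luce_p (map \<theta> (ordering_of n \<tau>)))"
    using luce by (intro sum.cong)
      (auto simp: T_def luce_distributed_def ordering_of_def comp_def)
  also have "\<dots> = (\<Sum>zs | zs \<in> permutations_of_set {1..n} \<and> Q zs. luce_p (map \<theta> zs))"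
  proof (rule sum.reindex_bij_betw)
    show "bij_betw (ordering_of n) T {zs \<in> permutations_of_set {1..n}. Q zs}"
      using bij_betw_ordering_of[of n]
      by (auto simp: bij_betw_def T_def inj_on_def)
  qed
  finally show ?thesis .
qed

section \<open>Consecutive patterns as restricted orderings\<close>

definition window :: "nat \<Rightarrow> nat \<Rightarrow> nat set" where
  "window k i = {i + 1..i + k}"

definition window_order :: "nat \<Rightarrow> (nat \<Rightarrow> nat) \<Rightarrow> nat \<Rightarrow> nat list" where
  "window_order k \<pi> i = map (\<lambda>j. i + inv \<pi> j) [1..<k + 1]"

lemma window_order_in_permutations_of_set:
  assumes "\<pi> permutes {1..k}"
  shows "window_order k \<pi> i \<in> permutations_of_set (window k i)"
proof -
  have "set (window_order k \<pi> i) = (+) i ` inv \<pi> ` {1..k}"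
    by (auto simp: window_order_def)
  also have "\<dots> = window k i"
    unfolding permutes_image[OF permutes_inv[OF assms]] window_def by simp
  finally have "set (window_order k \<pi> i) = window k i" .
  moreover have "distinct (window_order k \<pi> i)"
    using permutes_inj[OF permutes_inv[OF assms]]
    by (auto simp: window_order_def distinct_map inj_on_def)
  ultimately show ?thesis
    by (simp add: permutations_of_set_def)
qed

text \<open>Both sides say that \<open>\<sigma>\<close> increases along \<open>window_order k \<pi> i\<close>: a set has only one enumeration
  along which an injective function increases, and restricting the ordering of all items to the
  window gives such an enumeration.\<close>

lemma pat_window_eq_iff:
  assumes s: "\<sigma> permutes {1..n}" and p: "\<pi> permutes {1..k}" and ik: "i + k \<le> n"
  shows "pat (window k i) \<sigma> = \<pi>
    \<longleftrightarrow> filter (\<lambda>x. x \<in> window k i) (ordering_of n \<sigma>) = window_order k \<pi> i"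
proof -
  let ?W = "window k i" and ?L = "window_order k \<pi> i"
  let ?F = "filter (\<lambda>x. x \<in> window k i) (ordering_of n \<sigma>)"
  let ?inc = "sorted_wrt (\<lambda>x y. \<sigma> x < \<sigma> y)"
  have card: "card ?W = k" and fin: "finite ?W"
    by (simp_all add: window_def)
  have "\<exists>!\<tau>. \<tau> permutes {1..card ?W} \<and> same_order ?W \<sigma> \<tau>"
    using fin permutes_inj_on[OF s] by (rule pat_ex1)
  then have "pat ?W \<sigma> = \<pi> \<longleftrightarrow> same_order ?W \<sigma> \<pi>"
    unfolding pat_def using p card theI'[of "\<lambda>\<tau>. \<tau> permutes {1..card ?W} \<and> same_order ?W \<sigma> \<tau>"]
    by (metis (no_types, lifting))
  also have "\<dots> \<longleftrightarrow> (\<forall>a\<in>{1..k}. \<forall>b\<in>{1..k}. \<pi> a < \<pi> b \<longleftrightarrow> \<sigma> (i + a) < \<sigma> (i + b))"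
  proof -
    have "nth_elem ?W a = i + a" if "a \<in> {1..k}" for a
    proof -
      have "?W = {i + 1..<i + k + 1}"
        by (auto simp: window_def)
      then have "sorted_list_of_set ?W = [i + 1..<i + k + 1]"
        by (simp only: sorted_list_of_set_range)
      then show ?thesis
        using that by (simp add: nth_elem_def del: upt_Suc)
    qed
    then show ?thesis
      by (simp add: same_order_def card)
  qed
  also have "\<dots> \<longleftrightarrow> (\<forall>c\<in>{1..k}. \<forall>d\<in>{1..k}. c < d \<longrightarrow> \<sigma> (i + inv \<pi> c) < \<sigma> (i + inv \<pi> d))"
    (is "?l \<longleftrightarrow> ?r")
  proof
    assume l: ?l
    show ?r
    proof (intro ballI impI)
      fix c d assume cd: "c \<in> {1..k}" "d \<in> {1..k}" "c < d"
      have "inv \<pi> c \<in> {1..k}" "inv \<pi> d \<in> {1..k}"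
        using permutes_in_image[OF permutes_inv[OF p]] cd by blast+
      then show "\<sigma> (i + inv \<pi> c) < \<sigma> (i + inv \<pi> d)"
        using l cd(3) permutes_inverses(1)[OF p] by metis
    qed
  next
    assume r: ?r
    have less: "\<sigma> (i + a) < \<sigma> (i + b)" if "a \<in> {1..k}" "b \<in> {1..k}" "\<pi> a < \<pi> b" for a b
    proof -
      have "\<pi> a \<in> {1..k}" "\<pi> b \<in> {1..k}"
        using permutes_in_image[OF p] that by blast+
      then show ?thesis
        using r that(3) permutes_inverses(2)[OF p] by metis
    qed
    show ?l
    proof (intro ballI)
      fix a b assume ab: "a \<in> {1..k}" "b \<in> {1..k}"
      show "\<pi> a < \<pi> b \<longleftrightarrow> \<sigma> (i + a) < \<sigma> (i + b)"
      proof (cases "\<pi> a" "\<pi> b" rule: linorder_cases)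
        case equal
        then have "a = b" using permutes_inj[OF p] by (simp add: inj_eq)
        then show ?thesis by simp
      qed (use less[of a b] less[of b a] ab in auto)
    qed
  qed
  also have "\<dots> \<longleftrightarrow> ?inc ?L"
  proof
    assume r: "\<forall>c\<in>{1..k}. \<forall>d\<in>{1..k}. c < d \<longrightarrow> \<sigma> (i + inv \<pi> c) < \<sigma> (i + inv \<pi> d)"
    show "?inc ?L"
      unfolding window_order_def sorted_wrt_map
      by (rule sorted_wrt_mono_rel[OF _ sorted_wrt_upt]) (use r in auto)
  next
    assume inc: "?inc ?L"
    show "\<forall>c\<in>{1..k}. \<forall>d\<in>{1..k}. c < d \<longrightarrow> \<sigma> (i + inv \<pi> c) < \<sigma> (i + inv \<pi> d)"
    proof (intro ballI impI)
      fix c d assume cd: "c \<in> {1..k}" "d \<in> {1..k}" "c < d"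
      then have "\<sigma> (?L ! (c - 1)) < \<sigma> (?L ! (d - 1))"
        by (intro sorted_wrt_nth_less[OF inc]) (auto simp: window_order_def)
      then show "\<sigma> (i + inv \<pi> c) < \<sigma> (i + inv \<pi> d)"
        using cd by (simp add: window_order_def del: upt_Suc)
    qed
  qed
  also have "\<dots> \<longleftrightarrow> ?F = ?L"
  proof
    have "?inc (ordering_of n \<sigma>)"
      by (simp add: ordering_of_def sorted_wrt_map permutes_inverses[OF s] del: upt_Suc)
    then have F: "?inc ?F"
      by (rule sorted_wrt_filter)
    show "?inc ?L" if "?F = ?L"
      using F that by simp
    assume L: "?inc ?L"
    have "set (ordering_of n \<sigma>) = {1..n}"
      using bij_betw_ordering_of[of n] s by (auto simp: bij_betw_def permutations_of_set_def)
    then have "set ?F = ?W"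
      using ik by (auto simp: window_def)
    also have "\<dots> = set ?L"
      using window_order_in_permutations_of_set[OF p, of i] by (simp add: permutations_of_set_def)
    finally have "map \<sigma> ?F = map \<sigma> ?L"
      using F L by (intro strict_sorted_equal) (simp_all add: sorted_wrt_map)
    then show "?F = ?L"
      using permutes_inj[OF s] by (simp add: inj_map_eq_map)
  qed
  finally show ?thesis .
qed

lemma c_occ_eq_card_windows:
  assumes "k \<ge> 1"
  shows "c_occ k n \<pi> \<sigma> = card {i. i + k \<le> n \<and> pat (window k i) \<sigma> = \<pi>}"
proof -
  have "bij_betw (window k) {i. i + k \<le> n \<and> pat (window k i) \<sigma> = \<pi>}
     {I. I \<subseteq> {1..n} \<and> card I = k \<and> (\<exists>a b. I = {a..b}) \<and> pat I \<sigma> = \<pi>}"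
  proof (rule bij_betwI')
    fix i j assume "i \<in> {i. i + k \<le> n \<and> pat (window k i) \<sigma> = \<pi>}"
      "j \<in> {i. i + k \<le> n \<and> pat (window k i) \<sigma> = \<pi>}"
    show "window k i = window k j \<longleftrightarrow> i = j"
      using assms by (auto simp: window_def Icc_eq_Icc)
  next
    fix i assume "i \<in> {i. i + k \<le> n \<and> pat (window k i) \<sigma> = \<pi>}"
    then show "window k i \<in> {I. I \<subseteq> {1..n} \<and> card I = k \<and> (\<exists>a b. I = {a..b}) \<and> pat I \<sigma> = \<pi>}"
      by (auto simp: window_def)
  next
    fix I assume "I \<in> {I. I \<subseteq> {1..n} \<and> card I = k \<and> (\<exists>a b. I = {a..b}) \<and> pat I \<sigma> = \<pi>}"
    then obtain a b where I: "I = {a..b}" "I \<subseteq> {1..n}" "card I = k" "pat I \<sigma> = \<pi>"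
      by blast
    have ab: "a \<le> b" "Suc b - a = k"
      using I assms by auto
    then have "1 \<le> a" "b \<le> n"
      using I by auto
    then have "I = window k (a - 1)" "a - 1 + k \<le> n"
      using ab I(1) by (auto simp: window_def)
    then show "\<exists>i\<in>{i. i + k \<le> n \<and> pat (window k i) \<sigma> = \<pi>}. I = window k i"
      using I(4) by blast
  qed
  then show ?thesis
    unfolding c_occ_def by (rule bij_betw_same_card[symmetric])
qed

section \<open>Concentration\<close>

text \<open>Chebyshev's inequality: only the at most \<open>2kN\<close> pairs with \<open>\<bar>i - j\<bar> < k\<close> contribute to the
  variance, each of them at most 1.\<close>

lemma (in prob_space) finite_range_dependence_deviation:
  fixes E :: "nat \<Rightarrow> 'a set" and N k :: nat
  assumes ev: "\<And>i. i < N \<Longrightarrow> E i \<in> events"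
    and indep: "\<And>i j. i < N \<Longrightarrow> j < N \<Longrightarrow> i + k \<le> j \<Longrightarrow> prob (E i \<inter> E j) = prob (E i) * prob (E j)"
    and a: "a > 0"
  shows "prob {\<omega> \<in> space M. a \<le> \<bar>(\<Sum>i<N. indicator (E i) \<omega>) - (\<Sum>i<N. prob (E i))\<bar>}
    \<le> 2 * real k * real N / a\<^sup>2"
proof -
  define f :: "'a \<Rightarrow> real" where "f \<omega> = (\<Sum>i<N. indicator (E i) \<omega>)" for \<omega>
  have ind: "integrable M (indicator (E i) :: 'a \<Rightarrow> real)" if "i < N" for i
    using ev[OF that] by (simp add: emeasure_eq_measure)
  have ind2: "integrable M (\<lambda>\<omega>. indicator (E i) \<omega> * indicator (E j) \<omega> :: real)"
      "expectation (\<lambda>\<omega>. indicator (E i) \<omega> * indicator (E j) \<omega>) = prob (E i \<inter> E j)"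
    if "i < N" "j < N" for i j
  proof -
    have "E i \<inter> E j \<in> events" using ev that by blast
    then show "integrable M (\<lambda>\<omega>. indicator (E i) \<omega> * indicator (E j) \<omega> :: real)"
      "expectation (\<lambda>\<omega>. indicator (E i) \<omega> * indicator (E j) \<omega>) = prob (E i \<inter> E j)"
      by (simp_all add: indicator_inter_arith[symmetric] emeasure_eq_measure)
  qed
  have [measurable]: "f \<in> borel_measurable M"
    unfolding f_def using ev by (intro borel_measurable_sum) auto
  have sq: "f \<omega> ^ 2 = (\<Sum>i<N. \<Sum>j<N. indicator (E i) \<omega> * indicator (E j) \<omega>)" for \<omega>
    by (simp add: f_def power2_eq_square sum_product)
  have sq_int: "integrable M (\<lambda>\<omega>. f \<omega> ^ 2)"
    unfolding sq using ind2(1) by (intro Bochner_Integration.integrable_sum) auto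
  have mean: "expectation f = (\<Sum>i<N. prob (E i))"
    unfolding f_def using ind ev by (subst Bochner_Integration.integral_sum) auto
  have f_int: "integrable M f"
    unfolding f_def using ind by (intro Bochner_Integration.integrable_sum) auto
  have pair: "prob (E i \<inter> E j) - prob (E i) * prob (E j) \<le> of_bool (i < j + k \<and> j < i + k)"
    if "i < N" "j < N" for i j
  proof -
    consider "i < j + k" "j < i + k" | "i + k \<le> j" | "j + k \<le> i" by linarith
    then show ?thesis
    proof cases
      case 1
      have "prob (E i \<inter> E j) \<le> 1" "0 \<le> prob (E i) * prob (E j)" by simp_all
      then have "prob (E i \<inter> E j) - prob (E i) * prob (E j) \<le> 1" by linarith
      then show ?thesis using 1 by simp
    next
      case 2
      then show ?thesis using indep[OF that 2] by simp
    next
      case 3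
      then show ?thesis using indep[OF that(2,1) 3] by (simp add: Int_commute mult.commute)
    qed
  qed
  have "variance f = expectation (\<lambda>\<omega>. f \<omega> ^ 2) - (expectation f)\<^sup>2"
    by (rule variance_eq[OF f_int sq_int])
  also have "expectation (\<lambda>\<omega>. f \<omega> ^ 2) = (\<Sum>i<N. \<Sum>j<N. prob (E i \<inter> E j))"
  proof -
    have inner: "integrable M (\<lambda>\<omega>. \<Sum>j<N. indicator (E i) \<omega> * indicator (E j) \<omega> :: real)"
      if "i < N" for i
      using ind2(1) that by (intro Bochner_Integration.integrable_sum) auto
    have "expectation (\<lambda>\<omega>. f \<omega> ^ 2)
        = (\<Sum>i<N. expectation (\<lambda>\<omega>. \<Sum>j<N. indicator (E i) \<omega> * indicator (E j) \<omega>))"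
      unfolding sq by (rule Bochner_Integration.integral_sum) (rule inner, simp)
    also have "\<dots> = (\<Sum>i<N. \<Sum>j<N. prob (E i \<inter> E j))"
    proof (rule sum.cong[OF refl])
      fix i assume i: "i \<in> {..<N}"
      have "expectation (\<lambda>\<omega>. \<Sum>j<N. indicator (E i) \<omega> * indicator (E j) \<omega>)
          = (\<Sum>j<N. expectation (\<lambda>\<omega>. indicator (E i) \<omega> * indicator (E j) \<omega> :: real))"
        by (rule Bochner_Integration.integral_sum) (use ind2(1) i in simp)
      then show "expectation (\<lambda>\<omega>. \<Sum>j<N. indicator (E i) \<omega> * indicator (E j) \<omega>)
          = (\<Sum>j<N. prob (E i \<inter> E j))"
        using ind2(2) i by simp
    qed
    finally show ?thesis .
  qed
  also have "(\<Sum>i<N. \<Sum>j<N. prob (E i \<inter> E j)) - (expectation f)\<^sup>2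
      = (\<Sum>i<N. \<Sum>j<N. prob (E i \<inter> E j) - prob (E i) * prob (E j))"
    unfolding mean power2_eq_square sum_product by (simp only: sum_subtractf)
  also have "\<dots> \<le> (\<Sum>i<N. \<Sum>j<N. of_bool (i < j + k \<and> j < i + k))"
    using pair by (intro sum_mono) auto
  also have "\<dots> \<le> (\<Sum>i<N. 2 * real k)"
  proof (rule sum_mono)
    fix i
    have "(\<Sum>j<N. of_bool (i < j + k \<and> j < i + k)) = real (card {j. j < N \<and> i < j + k \<and> j < i + k})"
      by (simp add: sum.If_cases of_bool_def Int_def)
    also have "\<dots> \<le> real (card {i + 1 - k..<i + k})"
      by (intro of_nat_mono card_mono) auto
    also have "\<dots> \<le> 2 * real k"
      by simp
    finally show "(\<Sum>j<N. of_bool (i < j + k \<and> j < i + k)) \<le> 2 * real k" .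
  qed
  finally have "variance f \<le> 2 * real k * real N"
    by (simp add: mult.commute)
  then have "variance f / a\<^sup>2 \<le> 2 * real k * real N / a\<^sup>2"
    by (simp add: divide_right_mono)
  moreover have "prob {\<omega> \<in> space M. a \<le> \<bar>f \<omega> - expectation f\<bar>} \<le> variance f / a\<^sup>2"
    using sq_int a by (intro Chebyshev_inequality) auto
  ultimately show ?thesis
    unfolding mean unfolding f_def by linarith
qed

text \<open>The centring sum is the exact mean of the number of occurrences, and \<open>\<Lambda>\<close> is the limit of
  this mean divided by \<open>n\<close>. The deviation bound applies because windows whose left ends differ by
  at least \<open>k\<close> are disjoint.\<close>

lemma luce_c_occ_deviation:
  assumes k: "k \<ge> 1" and p: "\<pi> permutes {1..k}"
    and pos: "\<And>i. i \<in> {1..n} \<Longrightarrow> \<theta> i > 0"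
    and M: "prob_space M" and luce: "luce_distributed M \<sigma> n \<theta>" and a: "a > 0"
  shows "measure M {\<omega> \<in> space M. a \<le> \<bar>real (c_occ k n \<pi> (\<sigma> \<omega>))
      - (\<Sum>i | i + k \<le> n. luce_p (map \<theta> (window_order k \<pi> i)))\<bar>}
    \<le> 2 * real k * real n / a\<^sup>2"
proof -
  interpret prob_space M by fact
  define N where "N = n + 1 - k"
  define E where "E i = {\<omega> \<in> space M.
    filter (\<lambda>x. x \<in> window k i) (ordering_of n (\<sigma> \<omega>)) = window_order k \<pi> i}" for i
  have idx: "{i. i + k \<le> n} = {..<N}"
    by (auto simp: N_def)
  have sub: "window k i \<subseteq> {1..n}" if "i < N" for i
    using that by (auto simp: window_def N_def)
  have probE: "prob (E i) = luce_p (map \<theta> (window_order k \<pi> i))" if "i < N" for i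
    unfolding E_def
    using measure_ordering_of_luce[OF M luce,
        of "\<lambda>zs. filter (\<lambda>x. x \<in> window k i) zs = window_order k \<pi> i"]
      sum_luce_p_restriction[OF _ sub[OF that] pos window_order_in_permutations_of_set[OF p]]
    by simp
  have indep: "prob (E i \<inter> E j) = prob (E i) * prob (E j)"
    if "i < N" "j < N" "i + k \<le> j" for i j
  proof -
    have "window k i \<inter> window k j = {}"
      using that(3) by (auto simp: window_def)
    then have "(\<Sum>zs | zs \<in> permutations_of_set {1..n}
          \<and> filter (\<lambda>x. x \<in> window k i) zs = window_order k \<pi> i
          \<and> filter (\<lambda>x. x \<in> window k j) zs = window_order k \<pi> j. luce_p (map \<theta> zs))
        = luce_p (map \<theta> (window_order k \<pi> i)) * luce_p (map \<theta> (window_order k \<pi> j))"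
      using sub that pos window_order_in_permutations_of_set[OF p]
      by (intro sum_luce_p_disjoint_restrictions) auto
    moreover have "E i \<inter> E j = {\<omega> \<in> space M.
        filter (\<lambda>x. x \<in> window k i) (ordering_of n (\<sigma> \<omega>)) = window_order k \<pi> i
        \<and> filter (\<lambda>x. x \<in> window k j) (ordering_of n (\<sigma> \<omega>)) = window_order k \<pi> j}"
      by (auto simp: E_def)
    ultimately show ?thesis
      using measure_ordering_of_luce[OF M luce,
          of "\<lambda>zs. filter (\<lambda>x. x \<in> window k i) zs = window_order k \<pi> i
            \<and> filter (\<lambda>x. x \<in> window k j) zs = window_order k \<pi> j"] probE that
      by simp
  qed
  have ev: "E i \<in> events" for i
    unfolding E_def by (rule luce_distributed_events[OF luce])
  have count: "real (c_occ k n \<pi> (\<sigma> \<omega>)) = (\<Sum>i<N. indicator (E i) \<omega>)" if "\<omega> \<in> space M" for \<omega>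
  proof -
    have "\<sigma> \<omega> permutes {1..n}"
      using luce that by (auto simp: luce_distributed_def dest: measurable_space)
    then have "{i. i + k \<le> n \<and> pat (window k i) (\<sigma> \<omega>) = \<pi>} = {i \<in> {..<N}. \<omega> \<in> E i}"
      using pat_window_eq_iff[OF _ p] that idx by (auto simp: E_def)
    then show ?thesis
      unfolding c_occ_eq_card_windows[OF k]
      by (simp add: indicator_def of_bool_def sum.If_cases Int_def)
  qed
  have "{\<omega> \<in> space M. a \<le> \<bar>real (c_occ k n \<pi> (\<sigma> \<omega>))
      - (\<Sum>i | i + k \<le> n. luce_p (map \<theta> (window_order k \<pi> i)))\<bar>}
    = {\<omega> \<in> space M. a \<le> \<bar>(\<Sum>i<N. indicator (E i) \<omega>) - (\<Sum>i<N. prob (E i))\<bar>}"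
    unfolding idx using count probE by auto
  also have "prob \<dots> \<le> 2 * real k * real N / a\<^sup>2"
    using ev indep a by (intro finite_range_dependence_deviation) auto
  also have "\<dots> \<le> 2 * real k * real n / a\<^sup>2"
    using k by (intro divide_right_mono mult_left_mono) (auto simp: N_def)
  finally show ?thesis .
qed

theorem theorem3p1:
  fixes k :: nat and \<pi> :: "nat \<Rightarrow> nat"
    and \<theta> :: "nat \<Rightarrow> nat \<Rightarrow> real"
    and M :: "nat \<Rightarrow> 'a measure"
    and \<sigma> :: "nat \<Rightarrow> 'a \<Rightarrow> nat \<Rightarrow> nat"
    and \<Lambda> :: real
  assumes "k \<ge> 1" and "\<pi> permutes {1..k}"
    and "\<And>n i. i \<in> {1..n} \<Longrightarrow> \<theta> n i > 0"
    and "\<And>n. n \<ge> 1 \<Longrightarrow> prob_space (M n)"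
    and "\<And>n. n \<ge> 1 \<Longrightarrow> luce_distributed (M n) (\<sigma> n) n (\<theta> n)"
    and "(\<lambda>n. (\<Sum>i | i + k \<le> n. luce_p (map (\<lambda>j. \<theta> n (i + inv \<pi> j)) [1..<k + 1])) / real n)
           \<longlonglongrightarrow> \<Lambda>"
  shows "tendsto_in_prob M (\<lambda>n \<omega>. c_occ_density k n \<pi> (\<sigma> n \<omega>)) \<Lambda>"
  unfolding tendsto_in_prob_def
proof (intro allI impI)
  fix \<epsilon> :: real assume eps: "\<epsilon> > 0"
  define m where "m n = (\<Sum>i | i + k \<le> n. luce_p (map (\<theta> n) (window_order k \<pi> i)))" for n
  have lim: "(\<lambda>n. m n / real n) \<longlonglongrightarrow> \<Lambda>"
    using assms(6) by (simp add: m_def window_order_def comp_def del: upt_Suc)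
  have "\<forall>\<^sub>F n in sequentially.
      measure (M n) {\<omega> \<in> space (M n). \<bar>c_occ_density k n \<pi> (\<sigma> n \<omega>) - \<Lambda>\<bar> > \<epsilon>}
      \<le> (8 * real k / \<epsilon>\<^sup>2) / real n"
    using tendstoD[OF lim half_gt_zero[OF eps]] eventually_ge_at_top[of 1]
  proof eventually_elim
    case (elim n)
    interpret prob_space "M n" using assms(4) elim by simp
    \<comment> \<open>Once the mean density is within \<open>\<epsilon>/2\<close> of \<open>\<Lambda>\<close>, an error above \<open>\<epsilon>\<close> forces the count to be
      at least \<open>\<epsilon>n/2\<close> away from its mean.\<close>
    let ?bad = "{\<omega> \<in> space (M n). \<epsilon> / 2 * real n \<le> \<bar>real (c_occ k n \<pi> (\<sigma> n \<omega>)) - m n\<bar>}"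
    have "{\<omega> \<in> space (M n). \<bar>c_occ_density k n \<pi> (\<sigma> n \<omega>) - \<Lambda>\<bar> > \<epsilon>} \<subseteq> ?bad"
    proof clarify
      fix \<omega> assume far: "\<bar>c_occ_density k n \<pi> (\<sigma> n \<omega>) - \<Lambda>\<bar> > \<epsilon>"
      have "\<epsilon> / 2 \<le> \<bar>c_occ_density k n \<pi> (\<sigma> n \<omega>) - m n / real n\<bar>"
        using far elim(1) by (simp add: dist_real_def) argo
      also have "\<dots> = \<bar>real (c_occ k n \<pi> (\<sigma> n \<omega>)) - m n\<bar> / real n"
        by (simp add: c_occ_density_def flip: diff_divide_distrib)
      finally show "\<epsilon> / 2 * real n \<le> \<bar>real (c_occ k n \<pi> (\<sigma> n \<omega>)) - m n\<bar>"
        using elim(2) by (simp add: pos_le_divide_eq)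
    qed
    moreover have "?bad \<in> events"
      by (rule luce_distributed_events[OF assms(5)[OF elim(2)],
          where P = "\<lambda>\<tau>. \<epsilon> / 2 * real n \<le> \<bar>real (c_occ k n \<pi> \<tau>) - m n\<bar>"])
    ultimately have "measure (M n) {\<omega> \<in> space (M n). \<bar>c_occ_density k n \<pi> (\<sigma> n \<omega>) - \<Lambda>\<bar> > \<epsilon>}
        \<le> measure (M n) ?bad"
      by (rule finite_measure_mono)
    also have "\<dots> \<le> 2 * real k * real n / (\<epsilon> / 2 * real n)\<^sup>2"
      unfolding m_def using assms(1-5) elim(2) eps by (intro luce_c_occ_deviation) auto
    also have "\<dots> = (8 * real k / \<epsilon>\<^sup>2) / real n"
      using elim(2) eps by (simp add: field_simps power2_eq_square)
    finally show ?case .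
  qed
  then show
    "(\<lambda>n. measure (M n) {\<omega> \<in> space (M n). \<bar>c_occ_density k n \<pi> (\<sigma> n \<omega>) - \<Lambda>\<bar> > \<epsilon>}) \<longlonglongrightarrow> 0"
    by (intro Lim_null_comparison[OF _ lim_const_over_n[of "8 * real k / \<epsilon>\<^sup>2"]]) simp
qed

end
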